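(* If a topological dynamical system $(X,f)$ is weakly mixing, then it is disjoint from any minimal distal topological dynamical system $(Y,g)$.
   Context: $\mathbb{N}$ is the set of positive integers. A topological dynamical system is a pair $(X,f)$ where $(X,d)$ is a compact metric space and $f\colon X\to X$ is continuous. The (positive) orbit of $x$ is $\{f^n(x):n\in\mathbb{N}\}$; its closure is the orbit closure of $x$. The system is transitive if for any non-empty open $U,V\subset X$ there is $n\in\mathbb{N}$ with $f^n(U)\cap V\neq\emptyset$; it is minimal if every point has dense (positive) orbit. $(X,f)$ is weakly mixing if $(X\times X,f\times f)$ is transitive. Points $x,y\in X$ are proximal if there is an increasing sequence $\{n_k\}_{k=1}^\infty\subset\mathbb{N}$ with $\lim_{k\to\infty}d(f^{n_k}(x),f^{n_k}(y))=0$. A point is distal if it is not proximal to any point in its orbit closure other than itself, and a system is distal if all its points are distal (equivalently, the only proximal pairs are the diagonal ones). For continuous surjective maps $f,g$ acting on compact metric spaces $X,Y$ respectively, a non-empty closed set $J\subset X\times Y$ is a joining of $(X,f)$ and $(Y,g)$ if it is invariant for $f\times g$ and its projections onto the first and second coordinates are $X$ and $Y$ respectively. $(X,f)$ and $(Y,g)$ are disjoint if every joining of them equals $X\times Y$. (Weakly mixing systems and minimal systems automatically have surjective maps.) *)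

theory Defs
  imports "HOL-Analysis.Analysis"
begin

definition dynamical_system :: "'a::metric_space set \<Rightarrow> ('a \<Rightarrow> 'a) \<Rightarrow> bool" where
  "dynamical_system X f \<longleftrightarrow> compact X \<and> continuous_on X f \<and> f \<in> X \<rightarrow> X"

text \<open>Orbits are positive: the point \<open>x\<close> itself need not belong to its orbit.\<close>

definition orbit_pos :: "('a \<Rightarrow> 'a) \<Rightarrow> 'a \<Rightarrow> 'a set" where
  "orbit_pos f x = {(f ^^ n) x | n. 0 < n}"

definition transitive_system :: "'a::metric_space set \<Rightarrow> ('a \<Rightarrow> 'a) \<Rightarrow> bool" where
  "transitive_system X f \<longleftrightarrow>
    (\<forall>U V. openin (top_of_set X) U \<and> U \<noteq> {} \<and> openin (top_of_set X) V \<and> V \<noteq> {} \<longrightarrow>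
      (\<exists>n>0. (f ^^ n) ` U \<inter> V \<noteq> {}))"

definition weakly_mixing_system :: "'a::metric_space set \<Rightarrow> ('a \<Rightarrow> 'a) \<Rightarrow> bool" where
  "weakly_mixing_system X f \<longleftrightarrow> transitive_system (X \<times> X) (map_prod f f)"

definition minimal_system :: "'a::metric_space set \<Rightarrow> ('a \<Rightarrow> 'a) \<Rightarrow> bool" where
  "minimal_system X f \<longleftrightarrow> (\<forall>x\<in>X. X \<subseteq> closure (orbit_pos f x))"

definition proximal :: "('a::metric_space \<Rightarrow> 'a) \<Rightarrow> 'a \<Rightarrow> 'a \<Rightarrow> bool" where
  "proximal f x y \<longleftrightarrow>
    (\<exists>r::nat \<Rightarrow> nat. strict_mono r \<and> (\<forall>k. 0 < r k) \<and>
      (\<lambda>k. dist ((f ^^ r k) x) ((f ^^ r k) y)) \<longlonglongrightarrow> 0)"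

text \<open>The closure is taken in the ambient type; for a point of a dynamical system it agrees with
  the closure in \<open>X\<close>, because \<open>X\<close> is compact and contains the orbit.\<close>

definition distal_point :: "('a::metric_space \<Rightarrow> 'a) \<Rightarrow> 'a \<Rightarrow> bool" where
  "distal_point f x \<longleftrightarrow> (\<forall>y\<in>closure (orbit_pos f x). proximal f x y \<longrightarrow> y = x)"

definition distal_system :: "'a::metric_space set \<Rightarrow> ('a \<Rightarrow> 'a) \<Rightarrow> bool" where
  "distal_system X f \<longleftrightarrow> (\<forall>x\<in>X. distal_point f x)"

text \<open>Joinings and disjointness are meant for surjective maps \<open>f\<close> and \<open>g\<close>; weakly mixing and
  minimal systems are automatically surjective. Invariance of \<open>J\<close> is forward invariance,
  with an inclusion rather than an equality.\<close>

definition joining ::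
  "'a::metric_space set \<Rightarrow> ('a \<Rightarrow> 'a) \<Rightarrow> 'b::metric_space set \<Rightarrow> ('b \<Rightarrow> 'b) \<Rightarrow> ('a \<times> 'b) set \<Rightarrow> bool"
where
  "joining X f Y g J \<longleftrightarrow>
    J \<noteq> {} \<and> closedin (top_of_set (X \<times> Y)) J \<and> map_prod f g ` J \<subseteq> J \<and>
    fst ` J = X \<and> snd ` J = Y"

definition disjoint_systems ::
  "'a::metric_space set \<Rightarrow> ('a \<Rightarrow> 'a) \<Rightarrow> 'b::metric_space set \<Rightarrow> ('b \<Rightarrow> 'b) \<Rightarrow> bool" where
  "disjoint_systems X f Y g \<longleftrightarrow> (\<forall>J. joining X f Y g J \<longrightarrow> J = X \<times> Y)"

end

theory Submission
  imports Defs
begin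

text \<open>
  Let \<open>J\<close> be a joining. Weak mixing provides, by Baire's theorem, a pair \<open>(a, b)\<close> whose orbit
  under \<open>f \<times> f\<close> is dense in \<open>X \<times> X\<close>. The heart of the proof is that every such pair
  transfers points of \<open>J\<close>: if \<open>(a, y) \<in> J\<close> then \<open>(b, y) \<in> J\<close> (lemma \<open>joining_transfer\<close>).
  The reason is an interplay of return times. The times \<open>t\<close> at which both \<open>f\<^sup>t a\<close> and \<open>f\<^sup>t b\<close>
  are close to \<open>b\<close> exist because \<open>(b, b)\<close> lies in the closure of the orbit of \<open>(a, b)\<close>, and
  they form a filter base that is idempotent under addition: if \<open>s\<close> is such a time then
  \<open>f\<^sup>s\<close> maps a whole neighbourhood of \<open>b\<close> close to \<open>b\<close>, hence \<open>s + t\<close> is such a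
  time for all sufficiently good \<open>t\<close>. A distal point \<open>y\<close> returns to itself along
  every idempotent filter base (lemma \<open>distal_point_returns\<close>), so at suitable times
  the point \<open>(f\<^sup>t a, g\<^sup>t y)\<close> of \<open>J\<close> is close to \<open>(b, y)\<close>, and \<open>J\<close> is closed.

  The pairs \<open>(a, f\<^sup>n b)\<close> also have dense orbits, since \<open>id \<times> f\<^sup>n\<close> is surjective and commutes
  with \<open>f \<times> f\<close>. Hence \<open>(f\<^sup>n b, y) \<in> J\<close> for all \<open>n\<close>, and therefore \<open>X \<times> {y} \<subseteq> J\<close>
  because the orbit of \<open>b\<close> is dense. As \<open>f\<close> is surjective, \<open>f \<times> g\<close> moves this slice along the orbit of
  \<open>y\<close>, which is dense by minimality, so \<open>J = X \<times> Y\<close>.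

  The recurrence of distal points is an argument in the enveloping semigroup of \<open>g\<close>: the
  limits of \<open>g\<^sup>t\<close> along an idempotent filter base form a compact semigroup, which contains an
  idempotent \<open>p\<close> by the Ellis--Numakura lemma. As \<open>p (p y) = p y\<close>, the points \<open>y\<close> and \<open>p y\<close>
  are proximal, and distality forces \<open>p y = y\<close>.
\<close>

section \<open>Idempotents in compact semigroups of maps\<close>

lemma compact_fun_imp_closed:
  fixes S :: "('i \<Rightarrow> 'b::metric_space) set"
  assumes "compact S"
  shows "closed S"
proof -
  have "Hausdorff_space (product_topology (\<lambda>i::'i. euclidean :: 'b topology) UNIV)"
    by (simp add: Hausdorff_space_product_topology)
  then have "Hausdorff_space (euclidean :: ('i \<Rightarrow> 'b) topology)"
    by (simp add: euclidean_product_topology)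
  then have "closedin euclidean S"
    using assms by (intro compactin_imp_closedin) simp_all
  then show ?thesis by simp
qed

lemma continuous_on_comp_right:
  fixes p :: "'i \<Rightarrow> 'j"
  shows "continuous_on A (\<lambda>\<phi> :: 'j \<Rightarrow> 'b::topological_space. \<phi> \<circ> p)"
  unfolding comp_def
  by (intro continuous_on_coordinatewise_then_product)
     (rule continuous_on_subset[OF continuous_on_product_coordinates subset_UNIV])

text \<open>
  The Ellis--Numakura lemma. In a minimal closed subsemigroup \<open>M\<close>, for any \<open>p \<in> M\<close>, the left ideal
  \<open>M \<circ> p\<close> is again a closed subsemigroup, hence all of \<open>M\<close>, so some \<open>q \<in> M\<close> satisfies
  \<open>q \<circ> p = p\<close>. The solutions of this equation in turn form a closed subsemigroup, hence all
  of \<open>M\<close>; in particular \<open>p\<close> itself is a solution. The only continuity required is that of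
  \<open>\<phi> \<mapsto> \<phi> \<circ> p\<close>, which holds for arbitrary \<open>p\<close> in the topology of pointwise convergence.
\<close>

lemma exists_idempotent:
  fixes S :: "('b::metric_space \<Rightarrow> 'b) set"
  assumes "compact S" "S \<noteq> {}" and S: "\<And>\<phi> \<psi>. \<phi> \<in> S \<Longrightarrow> \<psi> \<in> S \<Longrightarrow> \<phi> \<circ> \<psi> \<in> S"
  shows "\<exists>p\<in>S. p \<circ> p = p"
proof -
  define \<A> where "\<A> = {A. A \<subseteq> S \<and> A \<noteq> {} \<and> closed A \<and> (\<forall>\<phi>\<in>A. \<forall>\<psi>\<in>A. \<phi> \<circ> \<psi> \<in> A)}"
  have S_mem: "S \<in> \<A>"
    using assms compact_fun_imp_closed by (auto simp: \<A>_def)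
  have "\<exists>M\<in>\<A>. \<forall>A\<in>\<A>. M \<supseteq> A \<longrightarrow> A = M"
  proof (rule predicate_Zorn)
    show "partial_order_on \<A> (relation_of (\<lambda>A B. A \<supseteq> B) \<A>)"
      by (rule partial_order_on_relation_ofI) auto
  next
    fix C assume C: "C \<in> Chains (relation_of (\<lambda>A B. A \<supseteq> B) \<A>)"
    then have CA: "C \<subseteq> \<A>" and chain: "\<And>A B. A \<in> C \<Longrightarrow> B \<in> C \<Longrightarrow> A \<subseteq> B \<or> B \<subseteq> A"
      by (auto simp: Chains_def relation_of_def)
    show "\<exists>u\<in>\<A>. \<forall>a\<in>C. a \<supseteq> u"
    proof (cases "C = {}")
      case True
      then show ?thesis using S_mem by auto
    next
      case False
      have "S \<inter> \<Inter>C \<noteq> {}"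
      proof (rule compact_imp_fip[OF \<open>compact S\<close>])
        show "closed T" if "T \<in> C" for T
          using that CA by (auto simp: \<A>_def)
        fix F assume F: "finite F" "F \<subseteq> C"
        show "S \<inter> \<Inter>F \<noteq> {}"
        proof (cases "F = {}")
          case True
          then show ?thesis using \<open>S \<noteq> {}\<close> by simp
        next
          case False
          then obtain m where m: "m \<in> F" "\<And>b. b \<in> F \<Longrightarrow> b \<subseteq> m \<Longrightarrow> m = b"
            using finite_has_minimal[OF F(1)] by blast
          \<comment> \<open>A minimal member of a finite chain is its least member.\<close>
          have "m \<subseteq> \<Inter>F"
            using m chain F by blast
          moreover have "m \<subseteq> S" "m \<noteq> {}"
            using m F CA by (auto simp: \<A>_def)
          ultimately show ?thesis by blast
        qed
      qed
      moreover have "\<Inter>C \<subseteq> S"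
        using False CA unfolding \<A>_def by blast
      moreover have "closed (\<Inter>C)"
        using CA by (intro closed_Inter) (auto simp: \<A>_def)
      moreover have "\<phi> \<circ> \<psi> \<in> \<Inter>C" if "\<phi> \<in> \<Inter>C" "\<psi> \<in> \<Inter>C" for \<phi> \<psi>
        using that CA unfolding \<A>_def by blast
      ultimately have "\<Inter>C \<in> \<A>"
        unfolding \<A>_def by blast
      then show ?thesis by blast
    qed
  qed
  then obtain M where M: "M \<in> \<A>" and min: "\<And>A. A \<in> \<A> \<Longrightarrow> A \<subseteq> M \<Longrightarrow> A = M"
    by blast
  from M have MS: "M \<subseteq> S" and "M \<noteq> {}" and clM: "closed M"
    and MM: "\<And>\<phi> \<psi>. \<phi> \<in> M \<Longrightarrow> \<psi> \<in> M \<Longrightarrow> \<phi> \<circ> \<psi> \<in> M"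
    by (auto simp: \<A>_def)
  have cptM: "compact M"
    using closed_Int_compact[OF clM \<open>compact S\<close>] MS by (simp add: inf_absorb1)
  obtain p where p: "p \<in> M" using \<open>M \<noteq> {}\<close> by blast
  let ?R = "(\<lambda>\<phi>. \<phi> \<circ> p) ` M"
  have "compact ?R"
    by (intro compact_continuous_image continuous_on_comp_right cptM)
  then have "closed ?R" by (rule compact_fun_imp_closed)
  moreover have "?R \<subseteq> M" using MM p by blast
  moreover have "(\<phi> \<circ> p) \<circ> (\<psi> \<circ> p) \<in> ?R" if "\<phi> \<in> M" "\<psi> \<in> M" for \<phi> \<psi>
    using that MM p by (intro image_eqI[where x = "\<phi> \<circ> p \<circ> \<psi>"]) (auto simp: comp_assoc)
  ultimately have "?R \<in> \<A>"
    using MS p unfolding \<A>_def by blast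
  then have "?R = M" using min \<open>?R \<subseteq> M\<close> by blast
  then obtain q where q: "q \<in> M" "q \<circ> p = p" using p by (metis imageE)
  let ?Q = "{\<phi> \<in> M. \<phi> \<circ> p = p}"
  have "?Q = M \<inter> (\<Inter>z. {\<phi>. \<phi> (p z) = p z})"
    by (auto simp: fun_eq_iff)
  moreover have "closed {\<phi> :: 'b \<Rightarrow> 'b. \<phi> (p z) = p z}" for z
    by (intro closed_Collect_eq continuous_on_product_coordinates continuous_on_const)
  ultimately have "closed ?Q"
    using clM by (simp only:) (intro closed_Int closed_INT ballI)
  moreover have "\<phi> \<circ> \<psi> \<in> ?Q" if "\<phi> \<in> ?Q" "\<psi> \<in> ?Q" for \<phi> \<psi>
    using that MM by (auto simp: comp_assoc)
  ultimately have "?Q \<in> \<A>"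
    using MS q unfolding \<A>_def by blast
  then have "?Q = M" using min by blast
  then show ?thesis using p MS by blast
qed

section \<open>Return times of distal points\<close>

lemma funpow_mem:
  assumes "g \<in> Y \<rightarrow> Y" "y \<in> Y"
  shows "(g ^^ n) y \<in> Y"
  using assms by (induction n) auto

lemma continuous_on_funpow:
  assumes "continuous_on Y g" "g \<in> Y \<rightarrow> Y"
  shows "continuous_on Y (g ^^ n)"
proof (induction n)
  case (Suc n)
  have "(g ^^ n) ` Y \<subseteq> Y" using funpow_mem[OF assms(2)] by auto
  then have "continuous_on Y (g \<circ> (g ^^ n))"
    by (intro continuous_on_compose Suc.IH continuous_on_subset[OF assms(1)])
  then show ?case by simp
qed auto

lemma proximalI:
  assumes close: "\<And>N \<epsilon>. \<epsilon> > 0 \<Longrightarrow> \<exists>n>N. dist ((g ^^ n) y) ((g ^^ n) z) < \<epsilon>"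
  shows "proximal g y z"
proof -
  have "\<forall>N k. \<exists>n>N. dist ((g ^^ n) y) ((g ^^ n) z) < 1 / Suc k"
    by (intro allI close) simp
  then obtain h where h: "\<And>N k. h N k > N"
    "\<And>N k. dist ((g ^^ h N k) y) ((g ^^ h N k) z) < 1 / Suc k"
    by metis
  define r where "r = rec_nat (h 0 0) (\<lambda>k m. h m (Suc k))"
  have r0: "r 0 = h 0 0" and rS: "r (Suc k) = h (r k) (Suc k)" for k
    by (auto simp: r_def)
  have mono: "strict_mono r"
    by (rule strict_monoI_Suc) (simp add: rS h)
  have pos: "0 < r k" for k
    using h(1)[of 0 0] r0 strict_mono_less_eq[OF mono, of 0 k] by simp
  have bound: "dist ((g ^^ r k) y) ((g ^^ r k) z) < 1 / Suc k" for k
  proof (cases k)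
    case 0
    then show ?thesis using h(2)[of 0 0] r0 by simp
  next
    case (Suc m)
    then show ?thesis using h(2)[of "r m" "Suc m"] rS[of m] by simp
  qed
  have "(\<lambda>k. dist ((g ^^ r k) y) ((g ^^ r k) z)) \<longlonglongrightarrow> 0"
  proof (rule tendsto_sandwich[OF _ _ tendsto_const LIMSEQ_inverse_real_of_nat])
    show "\<forall>\<^sub>F k in sequentially. dist ((g ^^ r k) y) ((g ^^ r k) z) \<le> inverse (real (Suc k))"
      using bound by (intro always_eventually allI) (simp add: inverse_eq_divide less_imp_le)
  qed simp
  then show ?thesis
    using mono pos unfolding proximal_def by blast
qed

text \<open>
  The sets \<open>T k\<close> are a filter base that is idempotent for addition; the finite sums of
  successive tails of a sequence are the standard example, so this is a form of Furstenberg's theorem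
  that the return times of a distal point meet every IP set. The limit points of \<open>g\<^sup>t\<close> along this
  filter base form the semigroup to which the Ellis--Numakura lemma is applied, and the filter base
  guarantees that its idempotent is a pointwise limit of \<open>g\<^sup>t\<close> with \<open>t \<in> T k\<close>.
\<close>

lemma distal_point_returns:
  fixes g :: "'b::metric_space \<Rightarrow> 'b"
  assumes Y: "dynamical_system Y g" and y: "y \<in> Y" "distal_point g y"
    and ne: "\<And>k. T k \<noteq> {}" and late: "\<And>k. T k \<subseteq> {k<..}"
    and decr: "\<And>k l. k \<le> l \<Longrightarrow> T l \<subseteq> T k"
    and add: "\<And>k s. s \<in> T k \<Longrightarrow> \<exists>l. \<forall>t\<in>T l. s + t \<in> T k"
    and "\<epsilon> > 0"
  shows "\<exists>t\<in>T k. dist ((g ^^ t) y) y < \<epsilon>"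
proof -
  have cpt: "compact Y" and cont: "continuous_on Y g" and inv: "g \<in> Y \<rightarrow> Y"
    using Y by (auto simp: dynamical_system_def)
  \<comment> \<open>Extending the iterates by the identity outside \<open>Y\<close> puts them into one product \<open>Z\<close> of
    compact sets, which is compact by Tychonoff's theorem.\<close>
  define G where "G t = (\<lambda>z. if z \<in> Y then (g ^^ t) z else z)" for t
  define Z where "Z = (\<Pi>\<^sub>E z\<in>UNIV. if z \<in> Y then Y else {z})"
  have ZD: "(z \<in> Y \<longrightarrow> \<phi> z \<in> Y) \<and> (z \<notin> Y \<longrightarrow> \<phi> z = z)" if "\<phi> \<in> Z" for \<phi> z
    using that by (auto simp: Z_def PiE_iff split: if_splits)
  have "compactin (product_topology (\<lambda>z::'b. euclidean) UNIV) Z"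
    unfolding Z_def compactin_PiE using cpt by auto
  then have cptZ: "compact Z" by (simp add: euclidean_product_topology)
  then have clZ: "closed Z" by (rule compact_fun_imp_closed)
  have GZ: "G t \<in> Z" for t
    using funpow_mem[OF inv] by (auto simp: G_def Z_def)
  have G_add: "G s \<circ> G t = G (s + t)" for s t
    using funpow_mem[OF inv] by (auto simp: G_def fun_eq_iff funpow_add)
  have G_cont: "continuous_on Z (\<lambda>\<psi>. G s \<circ> \<psi>)" for s
  proof (rule continuous_on_coordinatewise_then_product)
    fix z
    show "continuous_on Z (\<lambda>\<psi>. (G s \<circ> \<psi>) z)"
    proof (cases "z \<in> Y")
      case True
      have "continuous_on Z (\<lambda>\<psi>. (g ^^ s) (\<psi> z))"
        by (rule continuous_on_compose2[OF continuous_on_funpow[OF cont inv]])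
           (use True ZD in \<open>auto intro: continuous_on_subset[OF continuous_on_product_coordinates]\<close>)
      then show ?thesis
        by (rule continuous_on_eq) (use True ZD in \<open>auto simp: G_def\<close>)
    next
      case False
      have "z = (G s \<circ> \<psi>) z" if "\<psi> \<in> Z" for \<psi>
      proof -
        have "\<psi> z = z" using ZD that False by blast
        then show ?thesis using False by (simp add: G_def)
      qed
      then show ?thesis
        by (rule continuous_on_eq[OF continuous_on_const[of _ z]])
    qed
  qed
  define C where "C k = closure (G ` T k)" for k
  define S where "S = (\<Inter>k. C k)"
  have CZ: "C k \<subseteq> Z" for k
    unfolding C_def using GZ clZ by (intro closure_minimal) auto
  have "S \<subseteq> Z" using CZ by (auto simp: S_def)
  have "closed S" by (auto simp: S_def C_def)
  then have "compact S"
    using closed_Int_compact[OF _ cptZ] \<open>S \<subseteq> Z\<close> by (metis inf_absorb1)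
  moreover have "S \<noteq> {}"
  proof -
    have "Z \<inter> \<Inter>(range C) \<noteq> {}"
    proof (rule compact_imp_fip[OF cptZ])
      show "closed A" if "A \<in> range C" for A using that by (auto simp: C_def)
      fix F assume "finite F" "F \<subseteq> range C"
      then obtain K where K: "finite K" "F = C ` K" by (meson finite_subset_image)
      obtain m where m: "\<And>k. k \<in> K \<Longrightarrow> k \<le> m"
        using finite_nat_set_iff_bounded_le K(1) by auto
      obtain t where t: "t \<in> T m" using ne by blast
      have "G t \<in> C k" if "k \<in> K" for k
        using t decr[OF m[OF that]] closure_subset by (fastforce simp: C_def)
      then show "Z \<inter> \<Inter>F \<noteq> {}" using GZ K by blast
    qed
    then show ?thesis by (auto simp: S_def)
  qed
  moreover have "\<phi> \<circ> \<psi> \<in> S" if "\<phi> \<in> S" "\<psi> \<in> S" for \<phi> \<psi>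
  proof -
    \<comment> \<open>Composition depends continuously on its left factor, but on its right factor only if the
      left one is continuous on \<open>Y\<close>. So the right factor passes to the limit while the left one
      is still an iterate of \<open>g\<close>, and the left factor afterwards.\<close>
    have "\<phi> \<circ> \<psi> \<in> C k" for k
    proof -
      have "G s \<circ> \<psi> \<in> C k" if s: "s \<in> T k" for s
      proof -
        obtain l where l: "\<And>t. t \<in> T l \<Longrightarrow> s + t \<in> T k" using add[OF s] by blast
        have "(\<lambda>\<psi>. G s \<circ> \<psi>) ` closure (G ` T l) \<subseteq> C k"
        proof (rule image_closure_subset)
          show "continuous_on (closure (G ` T l)) (\<lambda>\<psi>. G s \<circ> \<psi>)"
            using continuous_on_subset[OF G_cont] CZ by (simp add: C_def)
          show "closed (C k)" by (simp add: C_def)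
          show "(\<lambda>\<psi>. G s \<circ> \<psi>) ` G ` T l \<subseteq> C k"
            using l closure_subset by (fastforce simp: C_def G_add)
        qed
        then show ?thesis using \<open>\<psi> \<in> S\<close> by (auto simp: S_def C_def)
      qed
      then have "(\<lambda>\<phi>. \<phi> \<circ> \<psi>) ` closure (G ` T k) \<subseteq> C k"
        by (intro image_closure_subset continuous_on_comp_right) (auto simp: C_def)
      then show ?thesis using \<open>\<phi> \<in> S\<close> by (auto simp: S_def C_def)
    qed
    then show ?thesis by (simp add: S_def)
  qed
  ultimately obtain p where p: "p \<in> S" "p \<circ> p = p"
    using exists_idempotent by blast
  have approx: "\<exists>t\<in>T m. dist ((g ^^ t) u) (p u) < \<delta> \<and> dist ((g ^^ t) v) (p v) < \<delta>"
    if "\<delta> > 0" "u \<in> Y" "v \<in> Y" for m \<delta> u v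
  proof -
    let ?N = "{\<phi>. dist (\<phi> u) (p u) < \<delta> \<and> dist (\<phi> v) (p v) < \<delta>}"
    have "open ?N"
      by (intro open_Collect_conj open_Collect_less continuous_intros continuous_on_product_coordinates)
    moreover have "p \<in> ?N" using \<open>\<delta> > 0\<close> by simp
    moreover have "p \<in> closure (G ` T m)" using p by (auto simp: S_def C_def)
    ultimately have "?N \<inter> G ` T m \<noteq> {}"
      using open_Int_closure_eq_empty by blast
    then show ?thesis using that by (auto simp: G_def)
  qed
  have pY: "p y \<in> Y" using p \<open>S \<subseteq> Z\<close> ZD y by blast
  have ppy: "p (p y) = p y" using p(2) by (metis comp_apply)
  have "proximal g y (p y)"
  proof (rule proximalI)
    fix N and \<delta> :: real assume "\<delta> > 0"
    then obtain t where "t \<in> T N" and t: "dist ((g ^^ t) y) (p y) < \<delta> / 2"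
      "dist ((g ^^ t) (p y)) (p y) < \<delta> / 2"
      using approx[of "\<delta> / 2" y "p y" N] y pY ppy by auto
    moreover have "dist ((g ^^ t) y) ((g ^^ t) (p y)) < \<delta>"
      using dist_triangle2[of "(g ^^ t) y" "(g ^^ t) (p y)" "p y"] t by linarith
    ultimately show "\<exists>n>N. dist ((g ^^ n) y) ((g ^^ n) (p y)) < \<delta>"
      using late by blast
  qed
  moreover have "p y \<in> closure (orbit_pos g y)"
    unfolding closure_approachable
  proof (intro allI impI)
    fix \<delta> :: real assume "\<delta> > 0"
    then obtain t where "t \<in> T 0" "dist ((g ^^ t) y) (p y) < \<delta>"
      using approx[of \<delta> y y 0] y by auto
    then show "\<exists>z\<in>orbit_pos g y. dist z (p y) < \<delta>"
      using late[of 0] by (auto simp: orbit_pos_def)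
  qed
  ultimately have "p y = y" using y by (auto simp: distal_point_def)
  then show ?thesis using approx[of \<epsilon> y y k] y \<open>\<epsilon> > 0\<close> by auto
qed

section \<open>Dense orbits\<close>

text \<open>The complement of the compact image is open, and no iterate of a point ever enters it.\<close>

lemma transitive_imp_surj:
  assumes "dynamical_system X f" "transitive_system X f"
  shows "f ` X = X"
proof (rule ccontr)
  assume "f ` X \<noteq> X"
  have inv: "f \<in> X \<rightarrow> X" and "compact X" "continuous_on X f"
    using assms by (auto simp: dynamical_system_def)
  then have "compact (f ` X)" by (intro compact_continuous_image)
  then have "closedin (top_of_set X) (f ` X)"
    using inv by (intro closed_subset compact_imp_closed) auto
  then have "openin (top_of_set X) (X - f ` X)"
    by (intro openin_diff) auto
  moreover have "X - f ` X \<noteq> {}" "X \<noteq> {}" using \<open>f ` X \<noteq> X\<close> inv by auto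
  ultimately obtain n x where "n > 0" "x \<in> X" "(f ^^ n) x \<notin> f ` X"
    using assms(2)[unfolded transitive_system_def, rule_format, of X "X - f ` X"] by auto
  moreover obtain m where "n = Suc m" using \<open>n > 0\<close> gr0_implies_Suc by blast
  ultimately show False using funpow_mem[OF inv] by auto
qed

text \<open>
  The set of points whose orbit visits a given small ball is open, and dense by transitivity. By
  compactness countably many balls suffice to detect dense orbits, so Baire's theorem applies.
\<close>

lemma transitive_imp_dense_orbit:
  fixes X :: "'a::metric_space set"
  assumes X: "dynamical_system X f" and tr: "transitive_system X f" and "X \<noteq> {}"
  shows "\<exists>x\<in>X. X \<subseteq> closure (orbit_pos f x)"
proof -
  have cpt: "compact X" and cont: "continuous_on X f" and inv: "f \<in> X \<rightarrow> X"
    using X by (auto simp: dynamical_system_def)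
  have "\<exists>D. finite D \<and> D \<subseteq> X \<and> X \<subseteq> (\<Union>c\<in>D. ball c (1 / Suc k))" for k
    using compactE_image[OF cpt, of X "\<lambda>c. ball c (1 / Suc k)"]
    by (metis UN_I centre_in_ball open_ball subsetI of_nat_0_less_iff zero_less_Suc zero_less_divide_1_iff)
  then obtain D where D: "\<And>k. finite (D k)" "\<And>k. D k \<subseteq> X"
    "\<And>k. X \<subseteq> (\<Union>c\<in>D k. ball c (1 / Suc k))" by metis
  define H where "H c k = (\<Union>n\<in>{0<..}. X \<inter> (f ^^ n) -` ball c (1 / Suc k))" for c and k :: nat
  let ?\<G> = "\<Union>k. (\<lambda>c. H c k) ` D k"
  have "(top_of_set X) closure_of \<Inter>?\<G> = topspace (top_of_set X)"
  proof (rule Baire_category)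
    have "compact_space (top_of_set X)" "Hausdorff_space (top_of_set X)"
      using cpt by (simp_all add: compact_space_subtopology Hausdorff_space_subtopology)
    then show "completely_metrizable_space (top_of_set X) \<or>
        locally_compact_space (top_of_set X) \<and> regular_space (top_of_set X)"
      by (simp add: compact_imp_locally_compact_space compact_Hausdorff_imp_regular_space)
    show "countable ?\<G>" using D(1) by (auto intro: countable_finite)
    fix A assume "A \<in> ?\<G>"
    then obtain c k where A: "A = H c k" and c: "c \<in> X" using D(2) by blast
    have op: "openin (top_of_set X) A"
      unfolding A H_def
      by (intro openin_Union ballI) (auto intro!: continuous_openin_preimage_gen continuous_on_funpow cont inv)
    have "U \<inter> A \<noteq> {}" if U: "openin (top_of_set X) U" "U \<noteq> {}" for U
    proof -
      have "openin (top_of_set X) (X \<inter> ball c (1 / Suc k))" "X \<inter> ball c (1 / Suc k) \<noteq> {}"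
        using c by (auto intro!: openin_open_Int exI[of _ c])
      then obtain n where "n > 0" "(f ^^ n) ` U \<inter> (X \<inter> ball c (1 / Suc k)) \<noteq> {}"
        using tr U unfolding transitive_system_def by meson
      then show ?thesis using openin_imp_subset[OF U(1)] by (fastforce simp: A H_def)
    qed
    then have "(top_of_set X) closure_of A = topspace (top_of_set X)"
      unfolding dense_intersects_open using openin_subset[OF op] by (auto simp: Int_commute)
    with op show "openin (top_of_set X) A \<and> (top_of_set X) closure_of A = topspace (top_of_set X)" ..
  qed
  then have "X \<inter> \<Inter>?\<G> \<noteq> {}"
    using \<open>X \<noteq> {}\<close> closure_of_restrict[of "top_of_set X" "\<Inter>?\<G>"] by fastforce
  then obtain x where x: "x \<in> X" "x \<in> \<Inter>?\<G>" by blast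
  then have xH: "x \<in> H c k" if "c \<in> D k" for k c
    using that by simp
  have "z \<in> closure (orbit_pos f x)" if "z \<in> X" for z
    unfolding closure_approachable
  proof (intro allI impI)
    fix e :: real assume "e > 0"
    then obtain k where k: "1 / Suc k < e / 2"
      using reals_Archimedean[of "e / 2"] by (auto simp: inverse_eq_divide)
    have "z \<in> (\<Union>c\<in>D k. ball c (1 / Suc k))" using D(3) that by blast
    then obtain c where c: "c \<in> D k" "dist c z < 1 / Suc k" by auto
    then obtain n where n: "n > 0" "dist c ((f ^^ n) x) < 1 / Suc k"
      using xH[OF c(1)] by (auto simp: H_def)
    have "dist ((f ^^ n) x) z < e"
      using dist_triangle3[of "(f ^^ n) x" z c] c(2) n(2) k by linarith
    then show "\<exists>u\<in>orbit_pos f x. dist u z < e" using n by (auto simp: orbit_pos_def)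
  qed
  then show ?thesis using x(1) by blast
qed

text \<open>
  A surjective self-map that commutes with the dynamics carries orbits to orbits and dense sets to
  dense sets. It is applied to the iterates of the dynamics, which shows that tails of dense orbits
  are dense, and to \<open>id \<times> f\<^sup>n\<close> on the square of a system.
\<close>

lemma dense_orbit_image:
  assumes dense: "X \<subseteq> closure (orbit_pos f x)" and X: "dynamical_system X f" and x: "x \<in> X"
    and h: "continuous_on X h" "h ` X = X" and comm: "\<And>z. z \<in> X \<Longrightarrow> h (f z) = f (h z)"
  shows "X \<subseteq> closure (orbit_pos f (h x))"
proof -
  have inv: "f \<in> X \<rightarrow> X" and "closed X"
    using X by (auto simp: dynamical_system_def compact_imp_closed)
  have comm_n: "h ((f ^^ n) x) = (f ^^ n) (h x)" for n
    using funpow_mem[OF inv x] comm by (induction n) auto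
  have "orbit_pos f x \<subseteq> X" using funpow_mem[OF inv x] by (auto simp: orbit_pos_def)
  then have "closure (orbit_pos f x) = X"
    using dense \<open>closed X\<close> by (metis closure_minimal subset_antisym)
  moreover have "h ` orbit_pos f x \<subseteq> closure (orbit_pos f (h x))"
    using closure_subset by (fastforce simp: orbit_pos_def comm_n)
  ultimately have "h ` X \<subseteq> closure (orbit_pos f (h x))"
    using image_closure_subset[of "orbit_pos f x" h] h(1) by simp
  then show ?thesis using h by simp
qed

lemma funpow_surj:
  assumes "f ` X = X"
  shows "(f ^^ n) ` X = X"
proof (induction n)
  case (Suc n)
  have "(f ^^ Suc n) ` X = f ` (f ^^ n) ` X" by (simp add: image_image)
  then show ?case using Suc assms by simp
qed simp

lemma funpow_map_prod:
  fixes f :: "'a \<Rightarrow> 'a" and g :: "'b \<Rightarrow> 'b"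
  shows "map_prod f g ^^ n = map_prod (f ^^ n) (g ^^ n)"
  by (induction n) (auto simp: fun_eq_iff)

lemma continuous_on_map_prod:
  assumes "continuous_on X h" "continuous_on Y k"
  shows "continuous_on (X \<times> Y) (map_prod h k)"
  unfolding map_prod_def case_prod_unfold
  by (intro continuous_on_Pair continuous_on_compose2[OF assms(1) continuous_on_fst]
      continuous_on_compose2[OF assms(2) continuous_on_snd] continuous_on_id) auto

lemma dynamical_system_square:
  assumes "dynamical_system X f"
  shows "dynamical_system (X \<times> X) (map_prod f f)"
  using assms unfolding dynamical_system_def
  by (intro conjI compact_Times continuous_on_map_prod) auto

lemma dense_orbit_late:
  assumes dense: "X \<subseteq> closure (orbit_pos f x)" and X: "dynamical_system X f" and x: "x \<in> X"
    and surj: "f ` X = X" and U: "open U" "X \<inter> U \<noteq> {}"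
  shows "\<exists>n>N. (f ^^ n) x \<in> U"
proof -
  have "X \<subseteq> closure (orbit_pos f ((f ^^ N) x))"
    using X by (intro dense_orbit_image[OF dense X x] continuous_on_funpow funpow_surj surj)
      (auto simp: dynamical_system_def funpow_swap1)
  then have "orbit_pos f ((f ^^ N) x) \<inter> U \<noteq> {}"
    using U open_Int_closure_eq_empty[OF U(1)] by blast
  then obtain m where m: "m > 0" "(f ^^ m) ((f ^^ N) x) \<in> U"
    by (auto simp: orbit_pos_def)
  then show ?thesis
    by (intro exI[of _ "m + N"]) (simp add: funpow_add)
qed

section \<open>Joinings of weakly mixing and distal systems\<close>

text \<open>
  The simultaneous visits of \<open>a\<close> and \<open>b\<close> to small balls around \<open>b\<close> supply the idempotent filter
  base along which the distal point \<open>y\<close> returns. Tracking \<open>b\<close> together with \<open>a\<close> is what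
  makes \<open>b\<close> an accumulation point of its own orbit along these times and hence
  the filter base idempotent.
\<close>

lemma joining_transfer:
  assumes X: "dynamical_system X f" and a: "a \<in> X" and b: "b \<in> X"
    and surj: "f ` X = X"
    and dense: "X \<times> X \<subseteq> closure (orbit_pos (map_prod f f) (a, b))"
    and Y: "dynamical_system Y g" and y: "y \<in> Y" "distal_point g y"
    and J: "closed J" "map_prod f g ` J \<subseteq> J" "(a, y) \<in> J"
  shows "(b, y) \<in> J"
proof -
  have cont: "continuous_on X f" and inv: "f \<in> X \<rightarrow> X"
    using X by (auto simp: dynamical_system_def)
  have XX: "dynamical_system (X \<times> X) (map_prod f f)"
    using X by (rule dynamical_system_square)
  have surj2: "map_prod f f ` (X \<times> X) = X \<times> X"
    using surj by (simp add: map_prod_surj_on)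
  define B where "B k = ball b (1 / Suc k)" for k :: nat
  define T where "T k = {t. k < t \<and> (f ^^ t) a \<in> B k \<and> (f ^^ t) b \<in> B k}" for k
  have Jn: "((f ^^ n) a, (g ^^ n) y) \<in> J" for n
    using J by (induction n) auto
  have ne: "T k \<noteq> {}" for k
  proof -
    have "\<exists>n>k. (map_prod f f ^^ n) (a, b) \<in> B k \<times> B k"
      by (rule dense_orbit_late[OF dense XX _ surj2])
         (use a b in \<open>auto simp: B_def intro!: open_Times exI[of _ b]\<close>)
    then show ?thesis by (auto simp: T_def funpow_map_prod)
  qed
  have ret: "\<exists>t\<in>T k. dist ((g ^^ t) y) y < \<epsilon>" if "\<epsilon> > 0" for k \<epsilon>
  proof (rule distal_point_returns[OF Y y _ _ _ _ \<open>\<epsilon> > 0\<close>])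
    show "T k \<noteq> {}" for k by (rule ne)
    show "T k \<subseteq> {k<..}" for k by (auto simp: T_def)
    have "B l \<subseteq> B k" if "k \<le> l" for k l
      unfolding B_def using that by (intro subset_ball divide_left_mono) auto
    then show "T l \<subseteq> T k" if "k \<le> l" for k l
      using that by (fastforce simp: T_def)
    fix k s assume s: "s \<in> T k"
    have "open (B k)" "(f ^^ s) b \<in> B k" using s by (auto simp: B_def T_def)
    then obtain r where r: "r > 0" "ball ((f ^^ s) b) r \<subseteq> B k"
      using open_contains_ball by blast
    have "continuous_on X (f ^^ s)" by (rule continuous_on_funpow[OF cont inv])
    then obtain \<delta> where \<delta>: "\<delta> > 0" "\<And>z. z \<in> X \<Longrightarrow> dist z b < \<delta> \<Longrightarrow> dist ((f ^^ s) z) ((f ^^ s) b) < r"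
      using b r(1) unfolding continuous_on_iff by blast
    have near: "(f ^^ s) z \<in> B k" if "z \<in> X" "dist z b < \<delta>" for z
      using \<delta>(2)[OF that] r(2) by (auto simp: dist_commute)
    obtain l where l: "1 / Suc l < \<delta>"
      using reals_Archimedean[OF \<delta>(1)] by (auto simp: inverse_eq_divide)
    have "s + t \<in> T k" if "t \<in> T l" for t
    proof -
      have "dist ((f ^^ t) a) b < \<delta>" "dist ((f ^^ t) b) b < \<delta>"
        using that l by (auto simp: T_def B_def dist_commute)
      then show ?thesis
        using s near funpow_mem[OF inv] a b by (auto simp: T_def funpow_add)
    qed
    then show "\<exists>l. \<forall>t\<in>T l. s + t \<in> T k" by blast
  qed
  have "(b, y) \<in> closure J"
    unfolding closure_approachable
  proof (intro allI impI)
    fix e :: real assume "e > 0"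
    obtain k where k: "1 / Suc k < e / 2"
      using reals_Archimedean[of "e / 2"] \<open>e > 0\<close> by (auto simp: inverse_eq_divide)
    obtain t where t: "t \<in> T k" "dist ((g ^^ t) y) y < e / 2"
      using ret[of "e / 2"] \<open>e > 0\<close> by auto
    have "dist ((f ^^ t) a, (g ^^ t) y) (b, y) \<le> dist ((f ^^ t) a) b + dist ((g ^^ t) y) y"
      unfolding dist_prod_def using sqrt_sum_squares_le_sum by simp
    also have "\<dots> < e"
      using t k by (auto simp: T_def B_def dist_commute)
    finally show "\<exists>z\<in>J. dist z (b, y) < e" using Jn by blast
  qed
  then show ?thesis using J by simp
qed

theorem corollary9:
  fixes X :: "'a::metric_space set" and f :: "'a \<Rightarrow> 'a"
    and Y :: "'b::metric_space set" and g :: "'b \<Rightarrow> 'b"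
  assumes "dynamical_system X f" and "weakly_mixing_system X f"
    and "dynamical_system Y g" and "minimal_system Y g" and "distal_system Y g"
  shows "disjoint_systems X f Y g"
  unfolding disjoint_systems_def
proof (intro allI impI)
  fix J assume "joining X f Y g J"
  then have J: "J \<noteq> {}" "closedin (top_of_set (X \<times> Y)) J" "map_prod f g ` J \<subseteq> J"
    and proj: "fst ` J = X" "snd ` J = Y"
    by (auto simp: joining_def)
  have cptX: "compact X" and contf: "continuous_on X f" and invf: "f \<in> X \<rightarrow> X"
    and cptY: "compact Y" and invg: "g \<in> Y \<rightarrow> Y"
    using assms by (auto simp: dynamical_system_def)
  have JXY: "J \<subseteq> X \<times> Y" using J(2) closedin_imp_subset by blast
  have clJ: "closed J"
    using J(2) closedin_closed_eq[OF compact_imp_closed[OF compact_Times[OF cptX cptY]]] by blast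
  let ?F = "map_prod f f"
  have XX: "dynamical_system (X \<times> X) ?F"
    using assms(1) by (rule dynamical_system_square)
  have tr: "transitive_system (X \<times> X) ?F"
    using assms(2) by (simp add: weakly_mixing_system_def)
  have "X \<noteq> {}" using J(1) proj by auto
  then obtain a b where a: "a \<in> X" and b: "b \<in> X"
    and dense: "X \<times> X \<subseteq> closure (orbit_pos ?F (a, b))"
    using transitive_imp_dense_orbit[OF XX tr] by auto
  have "fst ` (?F ` (X \<times> X)) = fst ` (X \<times> X)"
    using transitive_imp_surj[OF XX tr] by simp
  then have surj: "f ` X = X"
    using \<open>X \<noteq> {}\<close> by (force simp: image_image)
  have dense_b: "X \<subseteq> closure (orbit_pos f b)"
  proof
    fix x assume "x \<in> X"
    show "x \<in> closure (orbit_pos f b)"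
      unfolding closure_approachable
    proof (intro allI impI)
      fix e :: real assume "e > 0"
      have "(x, x) \<in> closure (orbit_pos ?F (a, b))" using dense \<open>x \<in> X\<close> by blast
      then obtain n where "n > 0" "dist ((f ^^ n) a, (f ^^ n) b) (x, x) < e"
        using \<open>e > 0\<close> by (auto simp: closure_approachable orbit_pos_def funpow_map_prod)
      then have "dist ((f ^^ n) b) x < e"
        using dist_snd_le[of "((f ^^ n) a, (f ^^ n) b)" "(x, x)"] by simp
      then show "\<exists>z\<in>orbit_pos f b. dist z x < e" using \<open>n > 0\<close> by (auto simp: orbit_pos_def)
    qed
  qed
  obtain y where y: "(a, y) \<in> J" using a proj by force
  then have "y \<in> Y" using JXY by blast
  have fnb: "((f ^^ n) b, y) \<in> J" for n
  proof (rule joining_transfer[OF assms(1) a _ surj _ assms(3) \<open>y \<in> Y\<close> _ clJ J(3) y])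
    show "(f ^^ n) b \<in> X" by (rule funpow_mem[OF invf b])
    show "distal_point g y" using assms(5) \<open>y \<in> Y\<close> by (simp add: distal_system_def)
    let ?h = "map_prod id (f ^^ n)"
    have "X \<times> X \<subseteq> closure (orbit_pos ?F (?h (a, b)))"
    proof (rule dense_orbit_image[OF dense XX])
      show "continuous_on (X \<times> X) ?h"
        by (intro continuous_on_map_prod continuous_on_funpow contf invf continuous_on_id')
      show "?h ` (X \<times> X) = X \<times> X"
        using funpow_surj[OF surj] by (simp add: map_prod_surj_on)
    qed (use a b in \<open>auto simp: funpow_swap1\<close>)
    then show "X \<times> X \<subseteq> closure (orbit_pos ?F (a, (f ^^ n) b))"
      by (simp only: map_prod_simp id_apply)
  qed
  have base: "(x, y) \<in> J" if "x \<in> X" for x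
  proof -
    have "(\<lambda>x. (x, y)) ` closure (orbit_pos f b) \<subseteq> J"
      using fnb by (intro image_closure_subset continuous_intros clJ) (auto simp: orbit_pos_def)
    then show ?thesis using dense_b that by blast
  qed
  have slice: "(x, (g ^^ n) y) \<in> J" if "x \<in> X" for x n
    using that
  proof (induction n arbitrary: x)
    case (Suc n)
    then obtain x' where "x' \<in> X" "x = f x'" using surj by blast
    then show ?case using Suc.IH[of x'] J(3) by auto
  qed (simp add: base)
  have "(x, z) \<in> J" if "x \<in> X" "z \<in> Y" for x z
  proof -
    have "(\<lambda>z. (x, z)) ` closure (orbit_pos g y) \<subseteq> J"
      using slice that by (intro image_closure_subset continuous_intros clJ) (auto simp: orbit_pos_def)
    moreover have "Y \<subseteq> closure (orbit_pos g y)"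
      using assms(4) \<open>y \<in> Y\<close> by (simp add: minimal_system_def)
    ultimately show ?thesis using that by blast
  qed
  then show "J = X \<times> Y" using JXY by auto
qed

end
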